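(* Let $\mathbf{P}\subset\mathbb{C}$ be a compact interval or a circle. Suppose that the pair $(A,B)\in C_{n,n}(\mathbf{P}) \times C_{n,m}(\mathbf{P})$ is pointwise reachable and that there exists a $v\in \mathbb{C}^m$ with $B(\theta)v\neq0$ for all $\theta\in\mathbf{P}$. Then there is a multiplication feedback operator $\mathcal{K}: C_{n}(\mathbf{P}) \to C_{m}(\mathbf{P})$, $(\mathcal{K}x)(\theta)=K(\theta)x(\theta)$ with $K\in C_{m,n}(\mathbf{P})$, such that $\mathcal{A}+\mathcal{B}\mathcal{K}$ is exponentially stable.
   Context: $C_n(\mathbf{P})$ and $C_{n,m}(\mathbf{P})$ denote the spaces of continuous functions on $\mathbf{P}$ with values in $\mathbb{C}^n$, respectively $\mathbb{C}^{n\times m}$; $C_n(\mathbf{P})$ carries the supremum norm. Here $\mathcal{A}+\mathcal{B}\mathcal{K}$ denotes the bounded multiplication operator on $C_n(\mathbf{P})$ given by $f\mapsto\big(\theta\mapsto (A(\theta)+B(\theta)K(\theta))f(\theta)\big)$. A bounded operator $\mathcal{G}$ on $C_n(\mathbf{P})$ is called exponentially stable if there are constants $M\ge1$, $\gamma>0$ with $\|e^{t\mathcal{G}}\|\le Me^{-\gamma t}$ for all $t\ge0$. A pair $(A,B)$ is pointwise reachable if for every $\theta\in\mathbf{P}$ the pair $(A(\theta),B(\theta))$ is reachable, i.e. $\operatorname{rank}(B(\theta),A(\theta)B(\theta),\dots,A(\theta)^{n-1}B(\theta))=n$. *)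

theory Defs
  imports "HOL-Analysis.Analysis"
begin

text \<open>
  Functions on a set \<open>P\<close> are represented by functions on all of \<open>complex\<close>. In the Banach space
  \<open>C\<^sub>n(P)\<close> they are normalised to vanish outside \<open>P\<close>, so that equality in the space is
  equality in HOL. Coefficient functions (\<open>A\<close>, \<open>B\<close>, \<open>K\<close>) are merely required to be continuous on \<open>P\<close>.
\<close>

definition C_space :: "complex set \<Rightarrow> (complex \<Rightarrow> complex ^ 'n) set" where
  "C_space P = {f. continuous_on P f \<and> (\<forall>\<theta>. \<theta> \<notin> P \<longrightarrow> f \<theta> = 0)}"

definition sup_norm :: "complex set \<Rightarrow> (complex \<Rightarrow> complex ^ 'n) \<Rightarrow> real" where
  "sup_norm P f = (SUP \<theta>\<in>P. norm (f \<theta>))"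

text \<open>The values of an operator on functions outside \<open>C_space P\<close> are irrelevant.\<close>

definition bounded_operator ::
    "complex set \<Rightarrow> ((complex \<Rightarrow> complex ^ 'n) \<Rightarrow> complex \<Rightarrow> complex ^ 'm) \<Rightarrow> bool" where
  "bounded_operator P G \<longleftrightarrow>
     (\<forall>f\<in>C_space P. G f \<in> C_space P) \<and>
     (\<forall>f\<in>C_space P. \<forall>g\<in>C_space P. G (\<lambda>\<theta>. f \<theta> + g \<theta>) = (\<lambda>\<theta>. G f \<theta> + G g \<theta>)) \<and>
     (\<forall>c. \<forall>f\<in>C_space P. G (\<lambda>\<theta>. c *s f \<theta>) = (\<lambda>\<theta>. c *s G f \<theta>)) \<and>
     (\<exists>b. \<forall>f\<in>C_space P. sup_norm P (G f) \<le> b * sup_norm P f)"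

definition op_norm ::
    "complex set \<Rightarrow> ((complex \<Rightarrow> complex ^ 'n) \<Rightarrow> complex \<Rightarrow> complex ^ 'm) \<Rightarrow> real" where
  "op_norm P G = (SUP f\<in>{f\<in>C_space P. sup_norm P f \<le> 1}. sup_norm P (G f))"

definition exp_partial_sum ::
    "((complex \<Rightarrow> complex ^ 'n) \<Rightarrow> complex \<Rightarrow> complex ^ 'n) \<Rightarrow> nat \<Rightarrow>
     (complex \<Rightarrow> complex ^ 'n) \<Rightarrow> complex \<Rightarrow> complex ^ 'n" where
  "exp_partial_sum G N f = (\<lambda>\<theta>. \<Sum>k<N. (G ^^ k) f \<theta> /\<^sub>R fact k)"

definition is_op_exp ::
    "complex set \<Rightarrow> ((complex \<Rightarrow> complex ^ 'n) \<Rightarrow> complex \<Rightarrow> complex ^ 'n) \<Rightarrow>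
     ((complex \<Rightarrow> complex ^ 'n) \<Rightarrow> complex \<Rightarrow> complex ^ 'n) \<Rightarrow> bool" where
  "is_op_exp P G E \<longleftrightarrow> bounded_operator P E \<and>
     (\<lambda>N. op_norm P (\<lambda>f \<theta>. exp_partial_sum G N f \<theta> - E f \<theta>)) \<longlonglongrightarrow> 0"

text \<open>
  The exponential is the limit of the exponential series in the operator norm. For nonempty compact
  \<open>P\<close> and bounded \<open>G\<close> it exists and is unique on \<open>C_space P\<close>; see \<open>is_op_exp_op_exp\<close> and
  \<open>is_op_exp_unique\<close> below.
\<close>

definition op_exp ::
    "complex set \<Rightarrow> ((complex \<Rightarrow> complex ^ 'n) \<Rightarrow> complex \<Rightarrow> complex ^ 'n) \<Rightarrow>
     (complex \<Rightarrow> complex ^ 'n) \<Rightarrow> complex \<Rightarrow> complex ^ 'n" where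
  "op_exp P G = (SOME E. is_op_exp P G E)"

definition exponentially_stable ::
    "complex set \<Rightarrow> ((complex \<Rightarrow> complex ^ 'n) \<Rightarrow> complex \<Rightarrow> complex ^ 'n) \<Rightarrow> bool" where
  "exponentially_stable P G \<longleftrightarrow> bounded_operator P G \<and>
     (\<exists>M\<ge>1. \<exists>\<gamma>>0. \<forall>t\<ge>0. op_norm P (op_exp P (\<lambda>f \<theta>. t *\<^sub>R G f \<theta>)) \<le> M * exp (- \<gamma> * t))"

definition mult_op ::
    "(complex \<Rightarrow> complex ^ 'n ^ 'm) \<Rightarrow> (complex \<Rightarrow> complex ^ 'n) \<Rightarrow> complex \<Rightarrow> complex ^ 'm" where
  "mult_op A f = (\<lambda>\<theta>. A \<theta> *v f \<theta>)"

text \<open>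
  The block matrix \<open>(B, A B, \<dots>, A\<^sup>n\<^sup>-\<^sup>1 B)\<close> with \<open>n = CARD('n)\<close>. Its columns are indexed by
  pairs \<open>(k, j)\<close>, denoting the \<open>j\<close>-th column of block \<open>k\<close>; the bijection \<open>to_nat_on UNIV\<close> from
  \<open>'n\<close> to \<open>{..<n}\<close> (see \<open>to_nat_on_finite\<close>) turns the block index into an exponent.
\<close>

definition reachability_matrix ::
    "complex ^ 'n ^ 'n \<Rightarrow> complex ^ 'm ^ 'n \<Rightarrow> complex ^ ('n \<times> 'm) ^ 'n" where
  "reachability_matrix A B =
     (\<chi> i p. (((\<lambda>X. A ** X) ^^ to_nat_on (UNIV :: 'n set) (fst p)) B) $ i $ snd p)"

definition reachable :: "complex ^ 'n ^ 'n \<Rightarrow> complex ^ 'm ^ 'n \<Rightarrow> bool" where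
  "reachable A B \<longleftrightarrow> rank (reachability_matrix A B) = CARD('n)"

definition pointwise_reachable ::
    "complex set \<Rightarrow> (complex \<Rightarrow> complex ^ 'n ^ 'n) \<Rightarrow> (complex \<Rightarrow> complex ^ 'm ^ 'n) \<Rightarrow> bool" where
  "pointwise_reachable P A B \<longleftrightarrow> (\<forall>\<theta>\<in>P. reachable (A \<theta>) (B \<theta>))"

lemma norm_le_sup_norm:
  assumes "compact P" "f \<in> C_space P" "\<theta> \<in> P"
  shows "norm (f \<theta>) \<le> sup_norm P f"
proof -
  have "compact ((\<lambda>\<theta>. norm (f \<theta>)) ` P)"
    using assms by (intro compact_continuous_image continuous_intros) (auto simp: C_space_def)
  then have "bdd_above ((\<lambda>\<theta>. norm (f \<theta>)) ` P)"
    by (simp add: bounded_imp_bdd_above compact_imp_bounded)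
  then show ?thesis
    unfolding sup_norm_def using assms(3) by (rule cSUP_upper2) simp
qed

lemma sup_norm_leI:
  assumes "P \<noteq> {}" "\<And>\<theta>. \<theta> \<in> P \<Longrightarrow> norm (f \<theta>) \<le> c"
  shows "sup_norm P f \<le> c"
  unfolding sup_norm_def using assms by (rule cSUP_least)

lemma sup_norm_nonneg:
  assumes "compact P" "P \<noteq> {}" "f \<in> C_space P"
  shows "0 \<le> sup_norm P f"
  using assms norm_le_sup_norm[OF assms(1,3)] by (meson all_not_in_conv norm_ge_zero order_trans)

lemma zero_in_C_space: "(\<lambda>_. 0) \<in> C_space P"
  by (simp add: C_space_def)

lemma op_norm_leI:
  assumes "P \<noteq> {}" "\<And>f. f \<in> C_space P \<Longrightarrow> sup_norm P f \<le> 1 \<Longrightarrow> sup_norm P (G f) \<le> c"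
  shows "op_norm P G \<le> c"
proof -
  have "sup_norm P (\<lambda>_. 0 :: complex ^ 'a) \<le> 1"
    using assms(1) by (intro sup_norm_leI) auto
  then have "{f \<in> C_space P. sup_norm P (f :: complex \<Rightarrow> complex ^ 'a) \<le> 1} \<noteq> {}"
    using zero_in_C_space by blast
  then show ?thesis
    unfolding op_norm_def using assms(2) by (intro cSUP_least) auto
qed

lemma sup_norm_le_op_norm:
  assumes P: "compact P" "P \<noteq> {}" and G: "bounded_operator P G"
    and f: "f \<in> C_space P" "sup_norm P f \<le> 1"
  shows "sup_norm P (G f) \<le> op_norm P G"
proof -
  obtain b where b: "\<And>f. f \<in> C_space P \<Longrightarrow> sup_norm P (G f) \<le> b * sup_norm P f"
    using G unfolding bounded_operator_def by blast
  have "sup_norm P (G g) \<le> \<bar>b\<bar>" if "g \<in> C_space P" "sup_norm P g \<le> 1" for g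
  proof -
    have "b * sup_norm P g \<le> \<bar>b\<bar> * 1"
      using that sup_norm_nonneg[OF P that(1)] by (intro mult_mono) auto
    then show ?thesis using b[OF that(1)] by simp
  qed
  then show ?thesis
    unfolding op_norm_def using f by (intro cSUP_upper) (auto intro!: bdd_aboveI)
qed

lemma scaleR_eq_vector_scalar: "r *\<^sub>R x = complex_of_real r *s (x :: complex ^ 'n)"
  unfolding vec_eq_iff by (simp only: vector_scaleR_component vector_smult_component)
    (simp add: scaleR_conv_of_real)

lemma bounded_operatorE:
  assumes "compact P" "P \<noteq> {}" "bounded_operator P G"
  obtains b where "0 \<le> b" "\<And>f. f \<in> C_space P \<Longrightarrow> sup_norm P (G f) \<le> b * sup_norm P f"
proof -
  obtain b where b: "\<And>f. f \<in> C_space P \<Longrightarrow> sup_norm P (G f) \<le> b * sup_norm P f"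
    using assms(3) unfolding bounded_operator_def by blast
  have "sup_norm P (G f) \<le> \<bar>b\<bar> * sup_norm P f" if "f \<in> C_space P" for f
    using b[OF that] mult_right_mono[OF abs_ge_self sup_norm_nonneg[OF assms(1,2) that]]
    by (rule order_trans)
  then show ?thesis using that[of "\<bar>b\<bar>"] by simp
qed

lemma C_space_add: "f \<in> C_space P \<Longrightarrow> g \<in> C_space P \<Longrightarrow> (\<lambda>\<theta>. f \<theta> + g \<theta>) \<in> C_space P"
  by (auto simp: C_space_def intro: continuous_intros)

lemma C_space_diff: "f \<in> C_space P \<Longrightarrow> g \<in> C_space P \<Longrightarrow> (\<lambda>\<theta>. f \<theta> - g \<theta>) \<in> C_space P"
  by (auto simp: C_space_def intro: continuous_intros)

lemma continuous_on_vector_scalar [continuous_intros]: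
  fixes f :: "'a::topological_space \<Rightarrow> complex ^ 'n"
  shows "continuous_on P f \<Longrightarrow> continuous_on P (\<lambda>\<theta>. c *s f \<theta>)"
  unfolding vector_scalar_mult_def by (intro continuous_intros)

lemma C_space_scale: "f \<in> C_space P \<Longrightarrow> (\<lambda>\<theta>. c *s f \<theta>) \<in> C_space P"
  by (auto simp: C_space_def intro: continuous_intros)

lemma exp_partial_sum_in_C_space:
  fixes G :: "(complex \<Rightarrow> complex ^ 'n) \<Rightarrow> complex \<Rightarrow> complex ^ 'n"
  assumes "bounded_operator P G" "f \<in> C_space P"
  shows "(G ^^ k) f \<in> C_space P" "exp_partial_sum G N f \<in> C_space P"
proof -
  show *: "(G ^^ k) f \<in> C_space P" for k
    using assms unfolding bounded_operator_def by (induction k) auto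
  show "exp_partial_sum G N f \<in> C_space P"
    using * unfolding exp_partial_sum_def C_space_def by (auto intro!: continuous_intros)
qed

lemma sup_norm_funpow_le:
  fixes G :: "(complex \<Rightarrow> complex ^ 'n) \<Rightarrow> complex \<Rightarrow> complex ^ 'n"
  assumes "bounded_operator P G" "f \<in> C_space P"
    and b: "0 \<le> b" "\<And>f. f \<in> C_space P \<Longrightarrow> sup_norm P (G f) \<le> b * sup_norm P f"
  shows "sup_norm P ((G ^^ k) f) \<le> b ^ k * sup_norm P f"
proof (induction k)
  case (Suc k)
  have "sup_norm P ((G ^^ Suc k) f) \<le> b * sup_norm P ((G ^^ k) f)"
    using b(2)[OF exp_partial_sum_in_C_space(1)[OF assms(1,2)]] by simp
  also have "\<dots> \<le> b * (b ^ k * sup_norm P f)"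
    using Suc b(1) by (rule mult_left_mono)
  finally show ?case by (simp add: mult.assoc)
qed simp

lemma funpow_linear:
  fixes G :: "(complex \<Rightarrow> complex ^ 'n) \<Rightarrow> complex \<Rightarrow> complex ^ 'n"
  assumes "bounded_operator P G" "f \<in> C_space P"
  shows "g \<in> C_space P \<Longrightarrow> (G ^^ k) (\<lambda>\<theta>. f \<theta> + g \<theta>) = (\<lambda>\<theta>. (G ^^ k) f \<theta> + (G ^^ k) g \<theta>)"
    and "(G ^^ k) (\<lambda>\<theta>. c *s f \<theta>) = (\<lambda>\<theta>. c *s (G ^^ k) f \<theta>)"
proof -
  note clo = exp_partial_sum_in_C_space(1)[OF assms(1)]
  have add: "\<And>f g. f \<in> C_space P \<Longrightarrow> g \<in> C_space P \<Longrightarrow> G (\<lambda>\<theta>. f \<theta> + g \<theta>) = (\<lambda>\<theta>. G f \<theta> + G g \<theta>)"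
    and scale: "\<And>c f. f \<in> C_space P \<Longrightarrow> G (\<lambda>\<theta>. c *s f \<theta>) = (\<lambda>\<theta>. c *s G f \<theta>)"
    using assms(1) unfolding bounded_operator_def by blast+
  show "(G ^^ k) (\<lambda>\<theta>. f \<theta> + g \<theta>) = (\<lambda>\<theta>. (G ^^ k) f \<theta> + (G ^^ k) g \<theta>)" if "g \<in> C_space P"
    by (induction k) (simp_all add: add clo assms(2) that)
  show "(G ^^ k) (\<lambda>\<theta>. c *s f \<theta>) = (\<lambda>\<theta>. c *s (G ^^ k) f \<theta>)"
    by (induction k) (simp_all add: scale clo assms(2))
qed

lemma is_op_exp_series:
  fixes G :: "(complex \<Rightarrow> complex ^ 'n) \<Rightarrow> complex \<Rightarrow> complex ^ 'n"
  assumes P: "compact P" "P \<noteq> {}" and G: "bounded_operator P G"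
  shows "is_op_exp P G (\<lambda>f \<theta>. \<Sum>k. (G ^^ k) f \<theta> /\<^sub>R fact k)" (is "is_op_exp P G ?E")
proof -
  obtain b where b: "0 \<le> b" "\<And>f. f \<in> C_space P \<Longrightarrow> sup_norm P (G f) \<le> b * sup_norm P f"
    using bounded_operatorE[OF P G] by blast
  define u where "u k = b ^ k / fact k" for k
  have u: "summable u"
    using summable_exp[of b] unfolding u_def divide_inverse by (simp only: mult.commute)
  have term_le: "norm ((G ^^ k) f \<theta> /\<^sub>R fact k) \<le> u k * sup_norm P f"
    if f: "f \<in> C_space P" for f k \<theta>
  proof (cases "\<theta> \<in> P")
    case True
    have "norm ((G ^^ k) f \<theta>) \<le> b ^ k * sup_norm P f"
      using norm_le_sup_norm[OF P(1) exp_partial_sum_in_C_space(1)[OF G f] True]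
        sup_norm_funpow_le[OF G f b] by (rule order_trans)
    then show ?thesis by (simp add: u_def divide_simps mult.commute)
  next
    case False
    then have "(G ^^ k) f \<theta> = 0"
      using exp_partial_sum_in_C_space(1)[OF G f] by (auto simp: C_space_def)
    then show ?thesis using b(1) sup_norm_nonneg[OF P f] by (simp add: u_def)
  qed
  have summ: "summable (\<lambda>k. (G ^^ k) f \<theta> /\<^sub>R fact k)" if "f \<in> C_space P" for f \<theta>
    by (rule summable_comparison_test'[OF summable_mult2[OF u]]) (use term_le[OF that] in auto)
  have tail: "norm (?E f \<theta> - exp_partial_sum G N f \<theta>) \<le> (\<Sum>k. u (k + N)) * sup_norm P f"
    if f: "f \<in> C_space P" for f \<theta> N
  proof -
    have "?E f \<theta> - exp_partial_sum G N f \<theta> = (\<Sum>k. (G ^^ (k + N)) f \<theta> /\<^sub>R fact (k + N))"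
      unfolding exp_partial_sum_def using suminf_minus_initial_segment[OF summ[OF f]] by simp
    also have "norm \<dots> \<le> (\<Sum>k. u (k + N) * sup_norm P f)"
      by (intro norm_suminf_le term_le[OF f] summable_mult2 summable_ignore_initial_segment[OF u])
    also have "\<dots> = (\<Sum>k. u (k + N)) * sup_norm P f"
      using summable_ignore_initial_segment[OF u] by (simp add: suminf_mult2)
    finally show ?thesis .
  qed
  have lim: "(\<lambda>N. \<Sum>k. u (k + N)) \<longlonglongrightarrow> 0"
    using suminf_exist_split2[OF u] .
  have clo: "?E f \<in> C_space P" if f: "f \<in> C_space P" for f
  proof -
    have "uniform_limit P (\<lambda>N \<theta>. \<Sum>k<N. (G ^^ k) f \<theta> /\<^sub>R fact k) (?E f) sequentially"
      by (rule Weierstrass_m_test[OF term_le[OF f] summable_mult2[OF u]])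
    moreover have "continuous_on P (\<lambda>\<theta>. \<Sum>k<N. (G ^^ k) f \<theta> /\<^sub>R fact k)" for N
      using exp_partial_sum_in_C_space(2)[OF G f] by (auto simp: C_space_def exp_partial_sum_def)
    ultimately have "continuous_on P (?E f)"
      by (intro uniform_limit_theorem[OF always_eventually]) auto
    moreover have "?E f \<theta> = 0" if "\<theta> \<notin> P" for \<theta>
      using exp_partial_sum_in_C_space(1)[OF G f] that by (simp add: C_space_def)
    ultimately show ?thesis by (simp add: C_space_def)
  qed
  have "bounded_operator P ?E"
    unfolding bounded_operator_def
  proof (intro conjI ballI allI exI)
    fix f g :: "complex \<Rightarrow> complex ^ 'n" and c :: complex
    assume f: "f \<in> C_space P"
    show "?E f \<in> C_space P" using clo[OF f] .
    have "(\<lambda>k. (G ^^ k) (\<lambda>\<theta>. c *s f \<theta>) \<theta> /\<^sub>R fact k) sums (c *s ?E f \<theta>)" for \<theta>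
    proof -
      have "bounded_linear (\<lambda>x :: complex ^ 'n. c *s x)"
        by (intro linear_conv_bounded_linear[THEN iffD1] linearI)
          (simp_all add: vec_eq_iff algebra_simps)
      from bounded_linear.sums[OF this summable_sums[OF summ[OF f, of \<theta>]]]
      show ?thesis
        by (simp add: funpow_linear(2)[OF G f] scaleR_eq_vector_scalar mult.commute)
    qed
    then show "?E (\<lambda>\<theta>. c *s f \<theta>) = (\<lambda>\<theta>. c *s ?E f \<theta>)"
      by (simp add: sums_iff fun_eq_iff)
    show "sup_norm P (?E f) \<le> (\<Sum>k. u k) * sup_norm P f"
      using tail[OF f, of _ 0] P(2) by (intro sup_norm_leI) (simp_all add: exp_partial_sum_def)
    assume g: "g \<in> C_space P"
    show "?E (\<lambda>\<theta>. f \<theta> + g \<theta>) = (\<lambda>\<theta>. ?E f \<theta> + ?E g \<theta>)"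
      by (simp add: funpow_linear(1)[OF G f g] scaleR_add_right suminf_add summ f g)
  qed
  moreover have "(\<lambda>N. op_norm P (\<lambda>f \<theta>. exp_partial_sum G N f \<theta> - ?E f \<theta>)) \<longlonglongrightarrow> 0"
  proof (rule tendsto_sandwich[OF _ _ tendsto_const lim])
    have upos: "0 \<le> (\<Sum>k. u (k + N))" for N
      using summable_ignore_initial_segment[OF u] b(1) by (intro suminf_nonneg) (auto simp: u_def)
    let ?D = "\<lambda>N f \<theta>. exp_partial_sum G N f \<theta> - ?E f \<theta>"
    have le: "sup_norm P (?D N f) \<le> (\<Sum>k. u (k + N))"
      if f: "f \<in> C_space P" "sup_norm P f \<le> 1" for N f
    proof (rule sup_norm_leI[OF P(2)])
      fix \<theta>
      have "norm (?D N f \<theta>) \<le> (\<Sum>k. u (k + N)) * sup_norm P f"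
        using tail[OF f(1)] by (simp add: norm_minus_commute)
      also have "\<dots> \<le> (\<Sum>k. u (k + N)) * 1"
        using f(2) upos by (rule mult_left_mono)
      finally show "norm (?D N f \<theta>) \<le> (\<Sum>k. u (k + N))" by simp
    qed
    show "\<forall>\<^sub>F N in sequentially. op_norm P (?D N) \<le> (\<Sum>k. u (k + N))"
      by (intro always_eventually allI op_norm_leI P(2) le)
    have "0 \<le> op_norm P (?D N)" for N
    proof -
      have z: "(\<lambda>_. 0 :: complex ^ 'n) \<in> C_space P" "sup_norm P (\<lambda>_. 0 :: complex ^ 'n) \<le> 1"
        using P(2) by (auto intro: zero_in_C_space sup_norm_leI)
      have "0 \<le> sup_norm P (?D N (\<lambda>_. 0))"
        using P z(1) clo exp_partial_sum_in_C_space(2)[OF G]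
        by (intro sup_norm_nonneg C_space_diff) auto
      also have "\<dots> \<le> op_norm P (?D N)"
        unfolding op_norm_def using z le by (intro cSUP_upper) (auto intro!: bdd_aboveI)
      finally show ?thesis .
    qed
    then show "\<forall>\<^sub>F N in sequentially. 0 \<le> op_norm P (?D N)"
      by simp
  qed
  ultimately show ?thesis unfolding is_op_exp_def ..
qed

lemma is_op_exp_op_exp:
  assumes "compact P" "P \<noteq> {}" "bounded_operator P G"
  shows "is_op_exp P G (op_exp P G)"
  unfolding op_exp_def using is_op_exp_series[OF assms] by (rule someI[of "is_op_exp P G"])

lemma bounded_operator_exp_diff:
  assumes P: "compact P" "P \<noteq> {}" and G: "bounded_operator P G" and E: "bounded_operator P E"
  shows "bounded_operator P (\<lambda>f \<theta>. exp_partial_sum G N f \<theta> - E f \<theta>)" (is "bounded_operator P ?D")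
proof -
  obtain b where b: "0 \<le> b" "\<And>f. f \<in> C_space P \<Longrightarrow> sup_norm P (G f) \<le> b * sup_norm P f"
    using bounded_operatorE[OF P G] by blast
  obtain c where c: "0 \<le> c" "\<And>f. f \<in> C_space P \<Longrightarrow> sup_norm P (E f) \<le> c * sup_norm P f"
    using bounded_operatorE[OF P E] by blast
  have E_closed: "\<And>f. f \<in> C_space P \<Longrightarrow> E f \<in> C_space P"
    and E_add: "\<And>f g. f \<in> C_space P \<Longrightarrow> g \<in> C_space P \<Longrightarrow> E (\<lambda>\<theta>. f \<theta> + g \<theta>) = (\<lambda>\<theta>. E f \<theta> + E g \<theta>)"
    and E_scale: "\<And>a f. f \<in> C_space P \<Longrightarrow> E (\<lambda>\<theta>. a *s f \<theta>) = (\<lambda>\<theta>. a *s E f \<theta>)"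
    using E unfolding bounded_operator_def by blast+
  show ?thesis
    unfolding bounded_operator_def
  proof (intro conjI ballI allI exI)
    fix f g :: "complex \<Rightarrow> complex ^ 'a" and a :: complex
    assume f: "f \<in> C_space P"
    show "?D f \<in> C_space P"
      using exp_partial_sum_in_C_space(2)[OF G f] E_closed[OF f] by (rule C_space_diff)
    show "?D (\<lambda>\<theta>. a *s f \<theta>) = (\<lambda>\<theta>. a *s ?D f \<theta>)"
      by (simp add: exp_partial_sum_def funpow_linear(2)[OF G f] E_scale[OF f] fun_eq_iff
          vec_eq_iff algebra_simps sum_distrib_left)
    show "sup_norm P (?D f) \<le> ((\<Sum>k<N. b ^ k / fact k) + c) * sup_norm P f"
    proof (rule sup_norm_leI[OF P(2)])
      fix \<theta> assume \<theta>: "\<theta> \<in> P"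
      have t: "norm ((G ^^ k) f \<theta> /\<^sub>R fact k) \<le> b ^ k / fact k * sup_norm P f" for k
        using order_trans[OF norm_le_sup_norm[OF P(1) exp_partial_sum_in_C_space(1)[OF G f] \<theta>]
            sup_norm_funpow_le[OF G f b]]
        by (simp add: divide_simps mult.commute)
      have "norm (?D f \<theta>) \<le> norm (exp_partial_sum G N f \<theta>) + norm (E f \<theta>)"
        by (rule norm_triangle_ineq4)
      also have "\<dots> \<le> (\<Sum>k<N. b ^ k / fact k * sup_norm P f) + c * sup_norm P f"
        unfolding exp_partial_sum_def
        using t order_trans[OF norm_le_sup_norm[OF P(1) E_closed[OF f] \<theta>] c(2)[OF f]]
        by (intro add_mono sum_norm_le) auto
      finally show "norm (?D f \<theta>) \<le> ((\<Sum>k<N. b ^ k / fact k) + c) * sup_norm P f"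
        by (simp add: sum_distrib_right distrib_right)
    qed
    assume g: "g \<in> C_space P"
    show "?D (\<lambda>\<theta>. f \<theta> + g \<theta>) = (\<lambda>\<theta>. ?D f \<theta> + ?D g \<theta>)"
      by (simp add: exp_partial_sum_def funpow_linear(1)[OF G f g] E_add[OF f g] fun_eq_iff
          scaleR_add_right sum.distrib)
  qed
qed

lemma is_op_exp_unique:
  assumes P: "compact P" "P \<noteq> {}" and G: "bounded_operator P G"
    and E: "is_op_exp P G E" and E': "is_op_exp P G E'" and f: "f \<in> C_space P"
  shows "E f = E' f"
proof -
  have lim: "(\<lambda>N. exp_partial_sum G N f \<theta>) \<longlonglongrightarrow> F f \<theta>"
    if F: "is_op_exp P G F" and \<theta>: "\<theta> \<in> P" for F \<theta>
  proof -
    define s where "s = 1 + sup_norm P f"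
    have s: "s > 0" using sup_norm_nonneg[OF P f] by (simp add: s_def)
    define g where "g = (\<lambda>\<theta>. complex_of_real (1 / s) *s f \<theta>)"
    have g: "g \<in> C_space P" unfolding g_def by (rule C_space_scale[OF f])
    have "sup_norm P g \<le> 1"
    proof (rule sup_norm_leI[OF P(2)])
      fix \<theta> assume "\<theta> \<in> P"
      then have "norm (f \<theta>) \<le> s" using norm_le_sup_norm[OF P(1) f] by (simp add: s_def add_increasing)
      then show "norm (g \<theta>) \<le> 1"
        using s by (simp add: g_def scaleR_eq_vector_scalar[symmetric] divide_simps del: of_real_divide)
    qed
    let ?D = "\<lambda>N f \<theta>. exp_partial_sum G N f \<theta> - F f \<theta>"
    have bo: "bounded_operator P (?D N)" for N
      using F by (intro bounded_operator_exp_diff P G) (simp add: is_op_exp_def)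
    have le: "norm (?D N f \<theta>) \<le> s * op_norm P (?D N)" for N
    proof -
      have "norm (?D N g \<theta>) \<le> op_norm P (?D N)"
        using bo[of N] norm_le_sup_norm[OF P(1) _ \<theta>, of "?D N g"]
          sup_norm_le_op_norm[OF P bo g \<open>sup_norm P g \<le> 1\<close>, of N] g
        unfolding bounded_operator_def by (meson order_trans)
      moreover have "?D N g = (\<lambda>\<theta>. complex_of_real (1 / s) *s ?D N f \<theta>)"
        using bo[of N] f unfolding bounded_operator_def g_def by blast
      then have "?D N g \<theta> = (1 / s) *\<^sub>R ?D N f \<theta>"
        unfolding scaleR_eq_vector_scalar by (rule fun_cong)
      then have "norm (?D N g \<theta>) = norm (?D N f \<theta>) / s"
        using s by (simp only: norm_scaleR) simp
      ultimately show ?thesis using s by (simp add: divide_simps mult.commute)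
    qed
    have "(\<lambda>N. s * op_norm P (?D N)) \<longlonglongrightarrow> 0"
      using F tendsto_mult_right_zero unfolding is_op_exp_def by blast
    then have "(\<lambda>N. ?D N f \<theta>) \<longlonglongrightarrow> 0"
      by (rule Lim_null_comparison[rotated]) (simp add: le)
    then show ?thesis by (rule LIM_zero_cancel)
  qed
  show ?thesis
  proof
    fix \<theta>
    show "E f \<theta> = E' f \<theta>"
    proof (cases "\<theta> \<in> P")
      case True
      then show ?thesis using LIMSEQ_unique lim[OF E] lim[OF E'] by blast
    next
      case False
      then show ?thesis
        using E E' f unfolding is_op_exp_def bounded_operator_def C_space_def by auto
    qed
  qed
qed

end

theory Submission
  imports Defs
begin

text \<open>
  The idea is to build, by a formula that is continuous in the coefficients, a quadratic Lyapunov
  function for every \<open>\<theta>\<close> at once; compactness of \<open>P\<close> then makes the decay uniform.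

  Choose a real \<open>\<mu>\<close> larger than the operator norm of every \<open>A(\<theta>)\<close>, which makes \<open>S = A + \<mu>\<close>
  pointwise invertible. For fixed \<open>\<theta>\<close> put
  \<open>Z\<^sub>k = (S\<^sup>-\<^sup>1 A)\<^sup>k S\<^sup>-\<^sup>1 B\<close> and \<open>W = \<Sum>k<n. Z\<^sub>k Z\<^sub>k\<^sup>*\<close>. The relations \<open>S Z\<^sub>0 = B\<close> and
  \<open>S Z\<^sub>k\<^sub>+\<^sub>1 = A Z\<^sub>k\<close> make \<open>S W S\<^sup>* - A W A\<^sup>*\<close> telescope to \<open>B B\<^sup>*\<close> minus a positive semidefinite
  matrix, and the same difference equals \<open>\<mu> (A W + W A\<^sup>*) + \<mu>\<^sup>2 W\<close>. Hence
  \<open>A W + W A\<^sup>* \<le> B B\<^sup>* / \<mu> - \<mu> W\<close> (\<open>gramian_lyapunov\<close>).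

  Up to multiplication by the invertible matrix \<open>S\<^sup>n\<close>, the matrix \<open>Z\<^sub>k\<close> is \<open>A\<^sup>k S\<^sup>n\<^sup>-\<^sup>1\<^sup>-\<^sup>k B\<close>, and the
  polynomials \<open>x\<^sup>k (x + \<mu>)\<^sup>n\<^sup>-\<^sup>1\<^sup>-\<^sup>k\<close> with \<open>k < n\<close> span the same space as \<open>1, x, \<dots>, x\<^sup>n\<^sup>-\<^sup>1\<close>. So
  reachability of \<open>(A, B)\<close> says precisely that \<open>W\<close> is positive definite (\<open>gramian_positive\<close>).

  With \<open>Q = W\<^sup>-\<^sup>1\<close> and \<open>K = - B\<^sup>* Q / (2 \<mu>)\<close> the term \<open>B B\<^sup>* / \<mu>\<close> cancels, and \<open>\<langle>Q x, x\<rangle>\<close> decays at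
  least like \<open>e\<^sup>-\<^sup>\<mu>\<^sup>t\<close> along the orbits of \<open>A + B K\<close> (\<open>exp_orbit_decay\<close>). Matrix inversion is
  continuous, hence so are \<open>Q\<close> and \<open>K\<close>, and on the compact set \<open>P\<close> the form \<open>\<langle>Q x, x\<rangle>\<close> lies between
  fixed positive multiples of \<open>\<parallel>x\<parallel>\<^sup>2\<close>. The decay of the orbits is therefore uniform in \<open>\<theta>\<close>, and
  since the exponential of a multiplication operator acts pointwise (\<open>op_exp_mult_op\<close>), it bounds the
  operator norm of the semigroup.

  Throughout, \<open>\<bullet>\<close> on \<open>complex ^ 'n\<close> is the real part of the Hermitian inner product; as the
  conjugate transpose is the adjoint for it, and \<open>\<mu>\<close> is real, it suffices for all estimates.
\<close>

section \<open>The conjugate transpose\<close>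

definition conj_transpose :: "complex ^ 'n ^ 'm \<Rightarrow> complex ^ 'm ^ 'n" where
  "conj_transpose X = (\<chi> i j. cnj (X $ j $ i))"

lemma inner_matrix_vector_conj_transpose:
  fixes X :: "complex ^ 'n ^ 'm"
  shows "(X *v x) \<bullet> y = x \<bullet> (conj_transpose X *v y)"
proof -
  have *: "(a * b) \<bullet> c = b \<bullet> (cnj a * c)" for a b c :: complex
    by (simp add: inner_complex_def algebra_simps)
  have "(X *v x) \<bullet> y = (\<Sum>i\<in>UNIV. \<Sum>j\<in>UNIV. x $ j \<bullet> (cnj (X $ i $ j) * y $ i))"
    by (simp add: inner_vec_def matrix_vector_mult_def inner_sum_left *)
  also have "\<dots> = (\<Sum>j\<in>UNIV. \<Sum>i\<in>UNIV. x $ j \<bullet> (cnj (X $ i $ j) * y $ i))"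
    by (rule sum.swap)
  also have "\<dots> = x \<bullet> (conj_transpose X *v y)"
    by (simp add: inner_vec_def matrix_vector_mult_def conj_transpose_def inner_sum_right)
  finally show ?thesis .
qed

lemma inner_matrix_vector_right:
  "x \<bullet> (X *v y) = (conj_transpose X *v x) \<bullet> y"
  by (metis inner_commute inner_matrix_vector_conj_transpose)

lemma conj_transpose_mult_vector:
  "conj_transpose (X ** Y) *v v = conj_transpose Y *v (conj_transpose X *v v)"
proof -
  have "x \<bullet> (conj_transpose (X ** Y) *v v) = x \<bullet> (conj_transpose Y *v (conj_transpose X *v v))" for x
    by (simp flip: inner_matrix_vector_conj_transpose matrix_vector_mul_assoc)
  then show ?thesis using vector_eq_ldot by blast
qed

lemma mat_complex_of_real_vector: "mat (complex_of_real \<mu>) *v x = \<mu> *\<^sub>R x"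
  by (simp add: vec_eq_iff matrix_vector_mult_def mat_def if_distrib[where f="\<lambda>a. a * _"]
      scaleR_conv_of_real[where 'a = complex] cong: if_cong)

lemma scaleR_complex_matrix_vector: "(r *\<^sub>R X) *v x = r *\<^sub>R (X *v x)" for X :: "complex ^ 'n ^ 'm"
  by (simp add: vec_eq_iff matrix_vector_mult_def scaleR_right.sum)

lemma conj_transpose_add_real_mat:
  "conj_transpose (A + mat (complex_of_real \<mu>)) *v v = conj_transpose A *v v + \<mu> *\<^sub>R v"
proof -
  have "x \<bullet> (conj_transpose (A + mat (complex_of_real \<mu>)) *v v)
      = x \<bullet> (conj_transpose A *v v + \<mu> *\<^sub>R v)" for x
    by (simp add: matrix_vector_mult_add_rdistrib inner_add_left inner_add_right mat_complex_of_real_vector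
        flip: inner_matrix_vector_conj_transpose)
  then show ?thesis using vector_eq_ldot by blast
qed

lemma matrix_inv_inverse:
  fixes X :: "complex ^ 'n ^ 'n"
  assumes "invertible X"
  shows "X ** matrix_inv X = mat 1" "matrix_inv X ** X = mat 1"
  using someI_ex[OF assms[unfolded invertible_def]] by (auto simp: matrix_inv_def)

lemma matrix_inv_right_vector:
  fixes X :: "complex ^ 'n ^ 'n"
  assumes "invertible X"
  shows "X *v (matrix_inv X *v v) = v"
  by (simp add: matrix_vector_mul_assoc matrix_inv_inverse[OF assms])

lemma conj_transpose_matrix_inv:
  fixes X :: "complex ^ 'n ^ 'n"
  assumes "invertible X"
  shows "conj_transpose (matrix_inv X) *v (conj_transpose X *v v) = v"
    and "conj_transpose X *v (conj_transpose (matrix_inv X) *v v) = v"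
proof -
  have "conj_transpose (mat 1) *v v = v"
    using conj_transpose_add_real_mat[of 0 1 v]
    by (simp add: conj_transpose_def matrix_vector_mult_def vec_eq_iff)
  then show "conj_transpose (matrix_inv X) *v (conj_transpose X *v v) = v"
    "conj_transpose X *v (conj_transpose (matrix_inv X) *v v) = v"
    using matrix_inv_inverse[OF assms] by (simp_all flip: conj_transpose_mult_vector)
qed

section \<open>Continuous families of matrices\<close>

lemma continuous_on_matrix_vector_mult:
  fixes F :: "'a::topological_space \<Rightarrow> complex ^ 'n ^ 'm"
  assumes "continuous_on S F" "continuous_on S f"
  shows "continuous_on S (\<lambda>s. F s *v f s)"
  unfolding matrix_vector_mult_def using assms by (intro continuous_intros)

lemma continuous_on_matrix_mult:
  fixes F :: "'a::topological_space \<Rightarrow> complex ^ 'n ^ 'm" and G :: "'a \<Rightarrow> complex ^ 'k ^ 'n"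
  assumes "continuous_on S F" "continuous_on S G"
  shows "continuous_on S (\<lambda>s. F s ** G s)"
  unfolding matrix_matrix_mult_def using assms by (intro continuous_intros)

lemma continuous_on_conj_transpose:
  "continuous_on S F \<Longrightarrow> continuous_on S (\<lambda>s. conj_transpose (F s))"
  unfolding conj_transpose_def by (intro continuous_intros)

lemma continuous_on_det:
  fixes F :: "'a::topological_space \<Rightarrow> complex ^ 'n ^ 'n"
  assumes "continuous_on S F"
  shows "continuous_on S (\<lambda>s. det (F s))"
  unfolding det_def using assms by (intro continuous_intros)

text \<open>By Cramer's rule the entries of the inverse are quotients of determinants.\<close>

lemma continuous_on_matrix_inv:
  fixes F :: "'a::topological_space \<Rightarrow> complex ^ 'n ^ 'n"
  assumes F: "continuous_on S F" and inv: "\<And>s. s \<in> S \<Longrightarrow> invertible (F s)"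
  shows "continuous_on S (\<lambda>s. matrix_inv (F s))"
proof -
  have entry: "matrix_inv (F s) $ k $ l =
      det (\<chi> i j. if j = k then axis l 1 $ i else F s $ i $ j) / det (F s)" if "s \<in> S" for s k l
  proof -
    have "F s *v (matrix_inv (F s) *v axis l 1) = axis l 1"
      using inv[OF that] by (rule matrix_inv_right_vector)
    then have "(matrix_inv (F s) *v axis l 1) $ k =
        det (\<chi> i j. if j = k then axis l 1 $ i else F s $ i $ j) / det (F s)"
      using inv[OF that] by (simp add: cramer invertible_det_nz)
    then show ?thesis 
      by (simp add: matrix_vector_mult_def axis_def if_distrib[where f="\<lambda>a. _ * a"] cong: if_cong)
  qed
  have "continuous_on S (\<lambda>s. det (\<chi> i j. if j = k then axis l 1 $ i else F s $ i $ j) / det (F s))"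
    for k l :: 'n
  proof (intro continuous_on_divide continuous_on_det F)
    show "continuous_on S (\<lambda>s. \<chi> i j. if j = k then axis l 1 $ i else F s $ i $ j)"
    proof (intro continuous_on_vec_lambda)
      fix i j show "continuous_on S (\<lambda>s. if j = k then axis l 1 $ i else F s $ i $ j)"
        using F by (cases "j = k") (auto intro!: continuous_intros)
    qed
  qed (use inv in \<open>simp add: invertible_det_nz\<close>)
  then have "continuous_on S (\<lambda>s. matrix_inv (F s) $ k $ l)" for k l
    by (subst continuous_on_cong[OF refl entry])
  then have "continuous_on S (\<lambda>s. \<chi> k l. matrix_inv (F s) $ k $ l)"
    by (intro continuous_on_vec_lambda)
  then show ?thesis by simp
qed

text \<open>
  By homogeneity in the vector, this bound and the next one reduce to a continuous function on the
  compact set \<open>P \<times> sphere 0 1\<close>.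
\<close>

lemma compact_matrix_family_bounded:
  fixes F :: "'a::topological_space \<Rightarrow> complex ^ 'n ^ 'm"
  assumes P: "compact P" and F: "continuous_on P F"
  obtains C where "C > 0" "\<And>\<theta> x. \<theta> \<in> P \<Longrightarrow> norm (F \<theta> *v x) \<le> C * norm x"
proof -
  have "compact ((\<lambda>p. F (fst p) *v snd p) ` (P \<times> sphere 0 1))"
    using P by (intro compact_continuous_image continuous_on_matrix_vector_mult compact_Times
        continuous_on_compose2[OF F] continuous_intros) auto
  then obtain C where C: "C > 0" "\<And>\<theta> u. \<theta> \<in> P \<Longrightarrow> norm u = 1 \<Longrightarrow> norm (F \<theta> *v u) \<le> C"
    using bounded_pos compact_imp_bounded by (force simp: bounded_pos)
  have "norm (F \<theta> *v x) \<le> C * norm x" if "\<theta> \<in> P" for \<theta> x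
  proof (cases "x = 0")
    case False
    define u where "u = (1 / norm x) *\<^sub>R x"
    have x: "x = norm x *\<^sub>R u" and u: "norm u = 1" using False by (simp_all add: u_def)
    have "norm (F \<theta> *v x) = norm x * norm (F \<theta> *v u)"
      by (subst x) (simp add: linear_scale[OF matrix_vector_mul_linear])
    also have "\<dots> \<le> norm x * C" by (intro mult_left_mono C(2) that u) simp
    finally show ?thesis by (simp add: mult.commute)
  qed simp
  with C(1) that show ?thesis by blast
qed

lemma compact_positive_family_bounded_below:
  fixes F :: "'a::topological_space \<Rightarrow> complex ^ 'n ^ 'n"
  assumes P: "compact P" "P \<noteq> {}" and F: "continuous_on P F"
    and pos: "\<And>\<theta> x. \<theta> \<in> P \<Longrightarrow> x \<noteq> 0 \<Longrightarrow> (F \<theta> *v x) \<bullet> x > 0"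
  obtains c where "c > 0" "\<And>\<theta> x. \<theta> \<in> P \<Longrightarrow> c * (norm x)\<^sup>2 \<le> (F \<theta> *v x) \<bullet> x"
proof -
  let ?S = "P \<times> sphere (0 :: complex ^ 'n) 1"
  have "continuous_on ?S (\<lambda>p. (F (fst p) *v snd p) \<bullet> snd p)"
    by (intro continuous_on_matrix_vector_mult continuous_on_compose2[OF F] continuous_intros) auto
  moreover have "compact ?S" using P(1) by (intro compact_Times) auto
  moreover have "?S \<noteq> {}"
    using P(2) vector_choose_size[of 1, where 'a = "complex ^ 'n"] by (auto simp: sphere_def dist_norm)
  ultimately obtain q where q: "q \<in> ?S"
    and le: "\<forall>p\<in>?S. (F (fst q) *v snd q) \<bullet> snd q \<le> (F (fst p) *v snd p) \<bullet> snd p"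
    using continuous_attains_inf[of ?S "\<lambda>p. (F (fst p) *v snd p) \<bullet> snd p"] by blast
  define c where "c = (F (fst q) *v snd q) \<bullet> snd q"
  have "c > 0" unfolding c_def using q by (intro pos) auto
  moreover have "c * (norm x)\<^sup>2 \<le> (F \<theta> *v x) \<bullet> x" if "\<theta> \<in> P" for \<theta> x
  proof (cases "x = 0")
    case False
    define u where "u = (1 / norm x) *\<^sub>R x"
    have x: "x = norm x *\<^sub>R u" and u: "norm u = 1" using False by (simp_all add: u_def)
    have "(F \<theta> *v x) \<bullet> x = (norm x)\<^sup>2 * ((F \<theta> *v u) \<bullet> u)"
      by (subst (1 2) x) (simp add: linear_scale[OF matrix_vector_mul_linear] power2_eq_square)
    moreover have "c \<le> (F \<theta> *v u) \<bullet> u"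
      using bspec[OF le, of "(\<theta>, u)"] that u by (simp add: c_def)
    ultimately show ?thesis by (simp add: mult.commute[of c] mult_left_mono)
  qed simp
  ultimately show ?thesis using that by blast
qed

section \<open>The Gramian\<close>

text \<open>
  The columns of these matrices are a Krylov sequence for the transform \<open>(A + \<mu>)\<^sup>-\<^sup>1 A\<close>
  of \<open>A\<close>, started at \<open>(A + \<mu>)\<^sup>-\<^sup>1 B\<close>. Using this transform instead of \<open>A\<close> itself is what turns
  a telescoping sum into a Lyapunov inequality.
\<close>

primrec cayley_krylov ::
    "real \<Rightarrow> complex ^ 'n ^ 'n \<Rightarrow> complex ^ 'm ^ 'n \<Rightarrow> nat \<Rightarrow> complex ^ 'm ^ 'n" where
  "cayley_krylov \<mu> A B 0 = matrix_inv (A + mat (complex_of_real \<mu>)) ** B"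
| "cayley_krylov \<mu> A B (Suc k) =
     matrix_inv (A + mat (complex_of_real \<mu>)) ** (A ** cayley_krylov \<mu> A B k)"

text \<open>
  A finite-horizon controllability Gramian of a discrete-time system. Stopping at the horizon \<open>n\<close>
  leaves a semidefinite remainder of favourable sign in the Lyapunov relation, and \<open>n\<close> terms are
  what reachability needs.
\<close>

definition gramian :: "real \<Rightarrow> complex ^ 'n ^ 'n \<Rightarrow> complex ^ 'm ^ 'n \<Rightarrow> complex ^ 'n ^ 'n" where
  "gramian \<mu> A B =
     (\<Sum>k<CARD('n). cayley_krylov \<mu> A B k ** conj_transpose (cayley_krylov \<mu> A B k))"

lemma matrix_vector_mult_sum_rdistrib: "(\<Sum>k\<in>I. X k) *v x = (\<Sum>k\<in>I. X k *v x)"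
  by (induction I rule: infinite_finite_induct) (simp_all add: matrix_vector_mult_add_rdistrib)

lemma inner_gramian:
  "x \<bullet> (gramian \<mu> A B *v y) = (\<Sum>k<CARD('n).
     (conj_transpose (cayley_krylov \<mu> A B k) *v x) \<bullet> (conj_transpose (cayley_krylov \<mu> A B k) *v y))"
  for A :: "complex ^ 'n ^ 'n"
  by (simp add: gramian_def matrix_vector_mult_sum_rdistrib inner_sum_right inner_matrix_vector_right
      flip: matrix_vector_mul_assoc)

lemma conj_transpose_cayley_krylov:
  fixes A :: "complex ^ 'n ^ 'n"
  assumes inv: "invertible (A + mat (complex_of_real \<mu>))"
  shows "conj_transpose (cayley_krylov \<mu> A B 0) *v (conj_transpose A *v x + \<mu> *\<^sub>R x) =
      conj_transpose B *v x"
    and "conj_transpose (cayley_krylov \<mu> A B (Suc k)) *v (conj_transpose A *v x + \<mu> *\<^sub>R x) =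
      conj_transpose (cayley_krylov \<mu> A B k) *v (conj_transpose A *v x)"
  unfolding conj_transpose_add_real_mat[symmetric]
  by (simp_all add: conj_transpose_mult_vector conj_transpose_matrix_inv[OF inv])

text \<open>
  With \<open>b\<^sub>k = Z\<^sub>k\<^sup>* p\<close> and \<open>a\<^sub>k = Z\<^sub>k\<^sup>* A\<^sup>* p\<close>, the recursion for \<open>Z\<^sub>k\<close> reads
  \<open>a\<^sub>k\<^sub>+\<^sub>1 + \<mu> b\<^sub>k\<^sub>+\<^sub>1 = a\<^sub>k\<close> and \<open>a\<^sub>0 + \<mu> b\<^sub>0 = B\<^sup>* p\<close>. Hence the sum of
  \<open>\<parallel>a\<^sub>k + \<mu> b\<^sub>k\<parallel>\<^sup>2 - \<parallel>a\<^sub>k\<parallel>\<^sup>2\<close> telescopes to at most \<open>\<parallel>B\<^sup>* p\<parallel>\<^sup>2\<close>, while expanding the squares gives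
  \<open>2 \<mu> \<langle>a\<^sub>k, b\<^sub>k\<rangle> + \<mu>\<^sup>2 \<parallel>b\<^sub>k\<parallel>\<^sup>2\<close>.
\<close>

lemma gramian_lyapunov:
  fixes A :: "complex ^ 'n ^ 'n"
  assumes \<mu>: "\<mu> > 0" and inv: "invertible (A + mat (complex_of_real \<mu>))"
  shows "2 * (p \<bullet> (A *v (gramian \<mu> A B *v p))) \<le>
    (norm (conj_transpose B *v p))\<^sup>2 / \<mu> - \<mu> * (p \<bullet> (gramian \<mu> A B *v p))"
proof -
  define a where "a k = conj_transpose (cayley_krylov \<mu> A B k) *v (conj_transpose A *v p)" for k
  define b where "b k = conj_transpose (cayley_krylov \<mu> A B k) *v p" for k
  define z where "z k = a k + \<mu> *\<^sub>R b k" for k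
  have z_eq: "z k = conj_transpose (cayley_krylov \<mu> A B k) *v (conj_transpose A *v p + \<mu> *\<^sub>R p)" for k
    by (simp add: z_def a_def b_def matrix_vector_right_distrib
        linear_scale[OF matrix_vector_mul_linear])
  have z0: "z 0 = conj_transpose B *v p" and zS: "z (Suc k) = a k" for k
    unfolding z_eq conj_transpose_cayley_krylov[OF inv] a_def by simp_all
  have telescope: "(\<Sum>k<n. (norm (z k))\<^sup>2 - (norm (a k))\<^sup>2) \<le> (norm (z 0))\<^sup>2" for n
  proof -
    have "(\<Sum>k<n. (norm (z k))\<^sup>2 - (norm (a k))\<^sup>2) = (norm (z 0))\<^sup>2 - (norm (z n))\<^sup>2"
      
      using sum_lessThan_telescope'[of "\<lambda>k. (norm (z k))\<^sup>2" n] by (simp add: zS)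
    then show ?thesis by simp
  qed
  have "(norm (z k))\<^sup>2 - (norm (a k))\<^sup>2 = 2 * \<mu> * (a k \<bullet> b k) + \<mu>\<^sup>2 * (b k \<bullet> b k)" for k
    unfolding z_def power2_norm_eq_inner
    by (simp only: inner_add_left inner_add_right inner_scaleR_left inner_scaleR_right
        inner_commute[of "b k" "a k"] power2_eq_square) (simp add: algebra_simps)
  then have "2 * \<mu> * (\<Sum>k<CARD('n). a k \<bullet> b k) + \<mu>\<^sup>2 * (\<Sum>k<CARD('n). b k \<bullet> b k)
      \<le> (norm (conj_transpose B *v p))\<^sup>2"
    using telescope[of "CARD('n)"] by (simp add: sum.distrib sum_distrib_left z0)
  moreover have "p \<bullet> (A *v (gramian \<mu> A B *v p)) = (\<Sum>k<CARD('n). a k \<bullet> b k)"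
    unfolding a_def b_def inner_gramian[symmetric]
    by (simp add: inner_matrix_vector_right)
  moreover have "p \<bullet> (gramian \<mu> A B *v p) = (\<Sum>k<CARD('n). b k \<bullet> b k)"
    unfolding b_def inner_gramian ..
  ultimately show ?thesis using \<mu> by (simp add: field_simps power2_eq_square)
qed

text \<open>
  The adjoint of \<open>S\<^sup>k\<^sup>+\<^sup>1 Z\<^sub>k = A\<^sup>k B\<close>; it holds because \<open>A\<close> and \<open>S = A + \<mu>\<close> commute.
\<close>

lemma conj_transpose_cayley_krylov_power:
  fixes A :: "complex ^ 'n ^ 'n"
  assumes inv: "invertible (A + mat (complex_of_real \<mu>))"
  defines "a \<equiv> (*v) (conj_transpose A)" and "s \<equiv> \<lambda>x. conj_transpose A *v x + \<mu> *\<^sub>R x"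
  shows "conj_transpose (cayley_krylov \<mu> A B k) *v ((s ^^ Suc k) y) = conj_transpose B *v ((a ^^ k) y)"
proof (induction k arbitrary: y)
  case 0
  show ?case using conj_transpose_cayley_krylov(1)[OF inv] by (simp add: a_def s_def)
next
  case (Suc k)
  have comm: "a ((s ^^ j) x) = (s ^^ j) (a x)" for j x
    by (induction j) (simp_all add: a_def s_def matrix_vector_right_distrib
        linear_scale[OF matrix_vector_mul_linear])
  have "conj_transpose (cayley_krylov \<mu> A B (Suc k)) *v ((s ^^ Suc (Suc k)) y) =
      conj_transpose (cayley_krylov \<mu> A B k) *v (a ((s ^^ Suc k) y))"
    using conj_transpose_cayley_krylov(2)[OF inv] by (simp add: a_def s_def)
  also have "\<dots> = conj_transpose B *v ((a ^^ k) (a y))"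
    unfolding comm by (rule Suc)
  finally show ?case by (simp add: funpow_swap1)
qed

text \<open>
  The hypothesis says that \<open>z\<close> is orthogonal to all columns of the reachability matrix, so that the
  conjugated entries of \<open>z\<close> are the coefficients of a linear relation between its \<open>n\<close> rows. A
  nonzero coefficient would make one row redundant and push the rank below \<open>n\<close>.
\<close>

lemma reachable_orthogonal_imp_zero:
  fixes A :: "complex ^ 'n ^ 'n" and B :: "complex ^ 'm ^ 'n"
  assumes reach: "reachable A B"
    and orth: "\<And>k. k < CARD('n) \<Longrightarrow> conj_transpose B *v (((*v) (conj_transpose A) ^^ k) z) = 0"
  shows "z = 0"
proof -
  let ?R = "reachability_matrix A B"
  have block: "conj_transpose (((\<lambda>X. A ** X) ^^ k) B) *v x =
      conj_transpose B *v (((*v) (conj_transpose A) ^^ k) x)" for k x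
    by (induction k arbitrary: x) 
      (simp_all add: conj_transpose_mult_vector funpow_swap1[of "(*v) (conj_transpose A)"])
  have col: "(\<Sum>i\<in>UNIV. cnj (?R $ i $ p) * z $ i) = 0" for p
  proof -
    have "to_nat_on (UNIV :: 'n set) (fst p) < CARD('n)"
      using to_nat_on_finite[of "UNIV :: 'n set"] by (auto simp: bij_betw_def)
    from orth[OF this]
    have "(conj_transpose (((\<lambda>X. A ** X) ^^ to_nat_on (UNIV :: 'n set) (fst p)) B) *v z) $ snd p = 0"
      unfolding block by simp
    then show ?thesis
      by (simp add: conj_transpose_def matrix_vector_mult_def reachability_matrix_def)
  qed
  have rows: "(\<Sum>i\<in>UNIV. cnj (z $ i) *s row i ?R) = 0"
  proof -
    have "cnj (\<Sum>i\<in>UNIV. cnj (?R $ i $ p) * z $ i) = 0" for p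
      by (simp only: col complex_cnj_zero)
    then show ?thesis by (simp add: vec_eq_iff row_def mult.commute)
  qed
  show ?thesis
  proof (rule ccontr)
    assume "z \<noteq> 0"
    then obtain i where i: "cnj (z $ i) \<noteq> 0" by (auto simp: vec_eq_iff)
    let ?W = "(\<lambda>j. row j ?R) ` (UNIV - {i})"
    have "row i ?R \<in> vec.span ?W"
    proof -
      have "cnj (z $ i) *s row i ?R = - (\<Sum>j\<in>UNIV - {i}. cnj (z $ j) *s row j ?R)"
        using rows by (simp add: sum.remove[of UNIV i] eq_neg_iff_add_eq_0)
      then have "row i ?R = (1 / cnj (z $ i)) *s (- (\<Sum>j\<in>UNIV - {i}. cnj (z $ j) *s row j ?R))"
        using i by (metis vec.scale_scale nonzero_divide_eq_eq vec.scale_one)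
      then show ?thesis
        by (metis (no_types, lifting) imageI vec.span_base vec.span_neg vec.span_scale vec.span_sum)
    qed
    then have "rows ?R \<subseteq> vec.span ?W"
      unfolding rows_def by (auto intro: vec.span_base)
    then have "vec.dim (rows ?R) \<le> card ?W"
      by (intro vec.dim_le_card) auto
    also have "\<dots> \<le> card (UNIV - {i})" by (rule card_image_le) simp
    also have "\<dots> < CARD('n)" by (simp add: card_Diff_singleton)
    finally show False
      using reach by (simp add: reachable_def row_rank_def_gen)
  qed
qed

text \<open>
  If the form vanishes at \<open>x = (S\<^sup>*)\<^sup>n w\<close>, then \<open>B\<^sup>* (A\<^sup>*)\<^sup>i (S\<^sup>*)\<^sup>j w = 0\<close> whenever
  \<open>i + j = n - 1\<close>. Since \<open>\<mu> = S\<^sup>* - A\<^sup>*\<close>, the relations for a total degree \<open>i + j\<close> imply those for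
  the next lower one; with \<open>j = 0\<close> they contradict reachability unless \<open>w = 0\<close>.
\<close>

lemma gramian_positive:
  fixes A :: "complex ^ 'n ^ 'n" and B :: "complex ^ 'm ^ 'n"
  assumes \<mu>: "\<mu> > 0" and inv: "invertible (A + mat (complex_of_real \<mu>))"
    and reach: "reachable A B" and x: "x \<noteq> 0"
  shows "x \<bullet> (gramian \<mu> A B *v x) > 0"
proof (rule ccontr)
  define a where "a = (*v) (conj_transpose A)"
  define s where "s x = conj_transpose A *v x + \<mu> *\<^sub>R x" for x
  assume "\<not> ?thesis"
  then have "(\<Sum>k<CARD('n). (conj_transpose (cayley_krylov \<mu> A B k) *v x) \<bullet>
      (conj_transpose (cayley_krylov \<mu> A B k) *v x)) = 0"
    unfolding inner_gramian by (intro antisym sum_nonneg) auto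
  then have Z: "conj_transpose (cayley_krylov \<mu> A B k) *v x = 0" if "k < CARD('n)" for k
    using that by (subst (asm) sum_nonneg_eq_0_iff) auto
  have "surj s"
    unfolding s_def conj_transpose_add_real_mat[symmetric]
    using conj_transpose_matrix_inv(2)[OF inv] by (metis surjI)
  then have "surj (s ^^ CARD('n))" by (rule surj_fn)
  then obtain w where w: "x = (s ^^ CARD('n)) w" by blast
  have add: "a (u + v) = a u + a v" and scale: "a (r *\<^sub>R v) = r *\<^sub>R a v" for u v r
    by (simp_all add: a_def matrix_vector_right_distrib linear_scale[OF matrix_vector_mul_linear])
  have s_eq: "s v = a v + \<mu> *\<^sub>R v" for v by (simp add: s_def a_def)
  have a_pow_s: "(a ^^ k) (s v) = (a ^^ Suc k) v + \<mu> *\<^sub>R (a ^^ k) v" for k v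
    by (induction k) (simp_all add: add scale s_eq)
  \<comment> \<open>Downward induction on the degree \<open>i + j\<close>: here \<open>d\<close> is its distance from \<open>n - 1\<close>.\<close>
  have "conj_transpose B *v ((a ^^ i) ((s ^^ j) w)) = 0" if "i + j + d + 1 = CARD('n)" for i j d
    using that
  proof (induction d arbitrary: i j)
    case 0
    have "CARD('n) = Suc i + j" using 0 by simp
    then have "(s ^^ Suc i) ((s ^^ j) w) = x" unfolding w by (simp only: funpow_add comp_apply)
    moreover have "conj_transpose (cayley_krylov \<mu> A B i) *v x = 0" using 0 by (intro Z) simp
    ultimately show ?case
      using conj_transpose_cayley_krylov_power[OF inv, of B i "(s ^^ j) w"]
      by (simp add: a_def s_def[abs_def])
  next
    case (Suc d)
    have "conj_transpose B *v ((a ^^ i) ((s ^^ Suc j) w)) = 0"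
      "conj_transpose B *v ((a ^^ Suc i) ((s ^^ j) w)) = 0"
      using Suc.prems by (intro Suc.IH; simp)+
    then have "\<mu> *\<^sub>R (conj_transpose B *v ((a ^^ i) ((s ^^ j) w))) = 0"
      unfolding funpow.simps(2)[of _ s] comp_apply a_pow_s
      by (simp add: matrix_vector_right_distrib linear_scale[OF matrix_vector_mul_linear])
    then show ?case using \<mu> by simp
  qed
  from this[of _ 0] have "conj_transpose B *v ((a ^^ k) w) = 0" if "k < CARD('n)" for k
    using less_imp_Suc_add[OF that] by fastforce
  then have "w = 0"
    unfolding a_def by (rule reachable_orthogonal_imp_zero[OF reach])
  moreover have "(s ^^ k) 0 = 0" for k by (induction k) (simp_all add: s_def)
  ultimately show False using w x by simp
qed

section \<open>Exponential decay from a quadratic Lyapunov function\<close>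

text \<open>
  For linear \<open>G\<close> this is \<open>e\<^sup>t\<^sup>G x\<close>. The series of vectors, rather than of operators, is the one that
  appears when the exponential of a multiplication operator is evaluated at a point.
\<close>

definition exp_orbit :: "('a::euclidean_space \<Rightarrow> 'a) \<Rightarrow> real \<Rightarrow> 'a \<Rightarrow> 'a" where
  "exp_orbit G t x = (\<Sum>k. (t ^ k / fact k) *\<^sub>R (G ^^ k) x)"

lemma summable_exp_orbit:
  fixes G :: "'a::euclidean_space \<Rightarrow> 'a"
  assumes G: "bounded_linear G"
  shows "summable (\<lambda>k. (t ^ k / fact k) *\<^sub>R (G ^^ k) x)"
proof -
  obtain C where C: "C \<ge> 0" "\<And>x. norm (G x) \<le> norm x * C"
    using bounded_linear.nonneg_bounded[OF G] by blast
  have pow: "norm ((G ^^ k) x) \<le> C ^ k * norm x" for k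
  proof (induction k)
    case (Suc k)
    have "norm ((G ^^ Suc k) x) \<le> norm ((G ^^ k) x) * C" using C(2) by simp
    also have "\<dots> \<le> C ^ k * norm x * C" using Suc C(1) by (rule mult_right_mono)
    finally show ?case by (simp add: mult_ac)
  qed simp
  have "norm ((t ^ k / fact k) *\<^sub>R (G ^^ k) x) \<le> inverse (fact k) * (\<bar>t\<bar> * C) ^ k * norm x" for k
    using mult_left_mono[OF pow[of k], of "\<bar>t\<bar> ^ k / fact k"]
    by (simp add: power_abs power_mult_distrib field_simps)
  then show ?thesis
    by (intro summable_comparison_test'[OF summable_mult2[OF summable_exp]]) auto
qed

text \<open>Every coordinate of the orbit is a real power series in \<open>t\<close>, differentiable term by term.\<close>

lemma exp_orbit_has_vector_derivative:
  fixes G :: "'a::euclidean_space \<Rightarrow> 'a"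
  assumes G: "bounded_linear G"
  shows "((\<lambda>t. exp_orbit G t x) has_vector_derivative G (exp_orbit G t x)) (at t)"
proof -
  have comp: "exp_orbit G t x \<bullet> b = (\<Sum>k. ((G ^^ k) x \<bullet> b / fact k) * t ^ k)" for t x b
    unfolding exp_orbit_def
    by (subst bounded_linear.suminf[OF bounded_linear_inner_left summable_exp_orbit[OF G]])
      (simp add: mult.commute)
  have summ: "summable (\<lambda>k. ((G ^^ k) x \<bullet> b / fact k) * t ^ k)" for t b
    using bounded_linear.summable[OF bounded_linear_inner_left summable_exp_orbit[OF G], of t x b]
    by (simp add: mult.commute)
  have "G (exp_orbit G t x) = exp_orbit G t (G x)"
    unfolding exp_orbit_def
    by (subst bounded_linear.suminf[OF G summable_exp_orbit[OF G]])
      (simp add: linear_scale[OF bounded_linear.linear[OF G]] funpow_swap1)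
  moreover have "((\<lambda>t. exp_orbit G t x \<bullet> b) has_field_derivative exp_orbit G t (G x) \<bullet> b) (at t)" for b
  proof -
    have "diffs (\<lambda>k. (G ^^ k) x \<bullet> b / fact k) = (\<lambda>k. (G ^^ k) (G x) \<bullet> b / fact k)"
      by (simp add: diffs_def fun_eq_iff funpow_swap1 del: of_nat_Suc)
    then show ?thesis
      using termdiffs_strong_converges_everywhere[OF summ, of b t] by (simp add: comp)
  qed
  ultimately show ?thesis
    unfolding has_vector_derivative_def
    by (subst has_derivative_componentwise_within) (auto simp: has_field_derivative_def mult_commute_abs)
qed

text \<open>
  Along an orbit \<open>y\<close>, the function \<open>e\<^sup>\<mu>\<^sup>s \<langle>Q y(s), y(s)\<rangle>\<close> has nonpositive derivative. Comparing its
  values at \<open>0\<close> and \<open>t\<close> and passing from the form \<open>Q\<close> to the squared norm costs the factor \<open>C / c\<close>.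
\<close>

lemma exp_orbit_decay:
  fixes G Q :: "'a::euclidean_space \<Rightarrow> 'a"
  assumes G: "bounded_linear G" and Q: "bounded_linear Q"
    and sym: "\<And>x y. Q x \<bullet> y = x \<bullet> Q y"
    and c: "c > 0" and lower: "\<And>x. c * (norm x)\<^sup>2 \<le> Q x \<bullet> x"
    and upper: "\<And>x. Q x \<bullet> x \<le> C * (norm x)\<^sup>2"
    and lyap: "\<And>x. 2 * (Q x \<bullet> G x) \<le> - \<mu> * (Q x \<bullet> x)"
    and t: "t \<ge> 0"
  shows "norm (exp_orbit G t x) \<le> sqrt (C / c) * exp (- (\<mu> / 2) * t) * norm x"
proof -
  define y where "y s = exp_orbit G s x" for s
  define \<phi> where "\<phi> s = exp (\<mu> * s) * (Q (y s) \<bullet> y s)" for s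
  have dy: "(y has_vector_derivative G (y s)) (at s)" for s
    unfolding y_def[abs_def] by (rule exp_orbit_has_vector_derivative[OF G])
  have d\<phi>: "(\<phi> has_real_derivative exp (\<mu> * s) * (2 * (Q (y s) \<bullet> G (y s)) + \<mu> * (Q (y s) \<bullet> y s))) (at s)"
    for s
  proof -
    have "((\<lambda>s. Q (y s) \<bullet> y s) has_vector_derivative (Q (y s) \<bullet> G (y s) + Q (G (y s)) \<bullet> y s)) (at s)"
      by (rule bounded_bilinear.has_vector_derivative[OF bounded_bilinear_inner
            bounded_linear.has_vector_derivative[OF Q dy] dy])
    moreover have "Q (y s) \<bullet> G (y s) + Q (G (y s)) \<bullet> y s = 2 * (Q (y s) \<bullet> G (y s))"
      using sym[of "G (y s)" "y s"] by (simp add: inner_commute)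
    ultimately have "((\<lambda>s. Q (y s) \<bullet> y s) has_real_derivative 2 * (Q (y s) \<bullet> G (y s))) (at s)"
      by (simp add: has_real_derivative_iff_has_vector_derivative)
    then show ?thesis
      unfolding \<phi>_def[abs_def] by (auto intro!: derivative_eq_intros simp: algebra_simps)
  qed
  have "\<phi> t \<le> \<phi> 0"
  proof (rule DERIV_nonpos_imp_nonincreasing[OF t])
    fix s
    have "exp (\<mu> * s) * (2 * (Q (y s) \<bullet> G (y s)) + \<mu> * (Q (y s) \<bullet> y s)) \<le> 0"
      using lyap[of "y s"] by (simp add: mult_le_0_iff)
    then show "\<exists>z. (\<phi> has_real_derivative z) (at s) \<and> z \<le> 0" using d\<phi> by blast
  qed
  moreover have "y 0 = x"
    unfolding y_def exp_orbit_def
    by (subst suminf_finite[of "{0}"]) auto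
  ultimately have "exp (\<mu> * t) * (Q (y t) \<bullet> y t) \<le> C * (norm x)\<^sup>2"
    using upper[of x] by (simp add: \<phi>_def)
  then have "exp (\<mu> * t) * (c * (norm (y t))\<^sup>2) \<le> C * (norm x)\<^sup>2"
    using mult_left_mono[OF lower[of "y t"], of "exp (\<mu> * t)"] by (meson exp_ge_zero order_trans)
  then have "(norm (y t))\<^sup>2 \<le> C / c * exp (- \<mu> * t) * (norm x)\<^sup>2"
    using c by (simp add: exp_minus field_simps)
  also have "exp (- \<mu> * t) = (exp (- (\<mu> / 2) * t))\<^sup>2"
    by (simp flip: exp_double)
  finally have "sqrt ((norm (y t))\<^sup>2) \<le> sqrt (C / c * (exp (- (\<mu> / 2) * t))\<^sup>2 * (norm x)\<^sup>2)"
    by (rule real_sqrt_le_mono)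
  then show ?thesis 
    by (simp only: y_def real_sqrt_mult real_sqrt_abs abs_norm_cancel abs_exp_cancel)
qed

section \<open>Multiplication operators\<close>

lemma bounded_operator_mult_op:
  fixes F :: "complex \<Rightarrow> complex ^ 'n ^ 'm"
  assumes P: "compact P" "P \<noteq> {}" and F: "continuous_on P F"
  shows "bounded_operator P (mult_op F)"
proof -
  obtain C where C: "C > 0" "\<And>\<theta> x. \<theta> \<in> P \<Longrightarrow> norm (F \<theta> *v x) \<le> C * norm x"
    using compact_matrix_family_bounded[OF P(1) F] by blast
  show ?thesis
    unfolding bounded_operator_def
  proof (intro conjI ballI allI exI)
    fix f g :: "complex \<Rightarrow> complex ^ 'n" and c :: complex
    assume f: "f \<in> C_space P"
    then show "mult_op F f \<in> C_space P"
      using F by (auto simp: C_space_def mult_op_def intro: continuous_on_matrix_vector_mult)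
    show "mult_op F (\<lambda>\<theta>. c *s f \<theta>) = (\<lambda>\<theta>. c *s mult_op F f \<theta>)"
      by (simp add: mult_op_def vector_scalar_commute)
    show "mult_op F (\<lambda>\<theta>. f \<theta> + g \<theta>) = (\<lambda>\<theta>. mult_op F f \<theta> + mult_op F g \<theta>)"
      by (simp add: mult_op_def matrix_vector_right_distrib)
    show "sup_norm P (mult_op F f) \<le> C * sup_norm P f"
    proof (rule sup_norm_leI[OF P(2)])
      fix \<theta> assume \<theta>: "\<theta> \<in> P"
      have "norm (F \<theta> *v f \<theta>) \<le> C * norm (f \<theta>)" using C(2)[OF \<theta>] .
      also have "\<dots> \<le> C * sup_norm P f"
        using C(1) norm_le_sup_norm[OF P(1) f \<theta>] by simp
      finally show "norm (mult_op F f \<theta>) \<le> C * sup_norm P f" by (simp add: mult_op_def)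
    qed
  qed
qed

text \<open>
  Uniqueness of the operator exponential on \<open>C_space P\<close> identifies it with the pointwise series.
\<close>

lemma op_exp_mult_op:
  fixes F :: "complex \<Rightarrow> complex ^ 'n ^ 'n"
  assumes P: "compact P" "P \<noteq> {}" and F: "continuous_on P F" and f: "f \<in> C_space P"
  shows "op_exp P (\<lambda>f \<theta>. t *\<^sub>R mult_op F f \<theta>) f = (\<lambda>\<theta>. exp_orbit ((*v) (F \<theta>)) t (f \<theta>))"
proof -
  let ?G = "\<lambda>f \<theta>. t *\<^sub>R mult_op F f \<theta>"
  have "?G = mult_op (\<lambda>\<theta>. t *\<^sub>R F \<theta>)"
    by (auto simp: mult_op_def fun_eq_iff vec_eq_iff matrix_vector_mult_def scaleR_right.sum)
  moreover have "continuous_on P (\<lambda>\<theta>. t *\<^sub>R F \<theta>)" using F by (intro continuous_intros)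
  ultimately have G: "bounded_operator P ?G"
    using bounded_operator_mult_op[OF P] by metis
  have pow: "(?G ^^ k) f \<theta> = t ^ k *\<^sub>R ((*v) (F \<theta>) ^^ k) (f \<theta>)" for k \<theta>
    by (induction k) (simp_all add: mult_op_def linear_scale[OF matrix_vector_mul_linear])
  have "op_exp P ?G f = (\<lambda>\<theta>. \<Sum>k. (?G ^^ k) f \<theta> /\<^sub>R fact k)"
    using is_op_exp_unique[OF P G is_op_exp_op_exp[OF P G] is_op_exp_series[OF P G] f] .
  then show ?thesis by (simp add: pow exp_orbit_def divide_inverse mult.commute)
qed

lemma mult_op_exponentially_stableI:
  fixes F :: "complex \<Rightarrow> complex ^ 'n ^ 'n"
  assumes P: "compact P" "P \<noteq> {}" and F: "continuous_on P F" and \<gamma>: "\<gamma> > 0"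
    and decay: "\<And>\<theta> t x. \<theta> \<in> P \<Longrightarrow> t \<ge> 0 \<Longrightarrow>
      norm (exp_orbit ((*v) (F \<theta>)) t x) \<le> M * exp (- \<gamma> * t) * norm x"
  shows "exponentially_stable P (mult_op F)"
  unfolding exponentially_stable_def
proof (intro conjI exI allI impI)
  show "bounded_operator P (mult_op F)" by (rule bounded_operator_mult_op[OF P F])
  show "max 1 M \<ge> 1" by simp
  show "\<gamma> > 0" by (rule \<gamma>)
  fix t :: real assume t: "t \<ge> 0"
  show "op_norm P (op_exp P (\<lambda>f \<theta>. t *\<^sub>R mult_op F f \<theta>)) \<le> max 1 M * exp (- \<gamma> * t)"
  proof (intro op_norm_leI[OF P(2)] sup_norm_leI[OF P(2)])
    fix f :: "complex \<Rightarrow> complex ^ 'n" and \<theta>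
    assume f: "f \<in> C_space P" "sup_norm P f \<le> 1" and \<theta>: "\<theta> \<in> P"
    have "norm (exp_orbit ((*v) (F \<theta>)) t (f \<theta>)) \<le> M * exp (- \<gamma> * t) * norm (f \<theta>)"
      by (rule decay[OF \<theta> t])
    also have "\<dots> \<le> max 1 M * exp (- \<gamma> * t) * 1"
      using norm_le_sup_norm[OF P(1) f(1) \<theta>] f(2) by (intro mult_mono) auto
    finally show "norm (op_exp P (\<lambda>f \<theta>. t *\<^sub>R mult_op F f \<theta>) f \<theta>) \<le> max 1 M * exp (- \<gamma> * t)"
      by (simp add: op_exp_mult_op[OF P F f(1)])
  qed
qed

section \<open>The stabilising feedback\<close>

lemma continuous_on_gramian:
  fixes A :: "'a::topological_space \<Rightarrow> complex ^ 'n ^ 'n" and B :: "'a \<Rightarrow> complex ^ 'm ^ 'n"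
  assumes A: "continuous_on P A" and B: "continuous_on P B"
    and inv: "\<And>\<theta>. \<theta> \<in> P \<Longrightarrow> invertible (A \<theta> + mat (complex_of_real \<mu>))"
  shows "continuous_on P (\<lambda>\<theta>. gramian \<mu> (A \<theta>) (B \<theta>))"
proof -
  have R: "continuous_on P (\<lambda>\<theta>. matrix_inv (A \<theta> + mat (complex_of_real \<mu>)))"
    using A inv by (intro continuous_on_matrix_inv continuous_intros)
  have "continuous_on P (\<lambda>\<theta>. cayley_krylov \<mu> (A \<theta>) (B \<theta>) k)" for k
    by (induction k) (simp_all add: continuous_on_matrix_mult R A B)
  then show ?thesis
    unfolding gramian_def
    by (intro continuous_on_sum continuous_on_matrix_mult continuous_on_conj_transpose)
qed

text \<open>
  For \<open>p = Q x\<close> one has \<open>x = W p\<close>, so the Lyapunov inequality of the Gramian, tested with \<open>p\<close>,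
  becomes \<open>2 \<langle>Q x, (A + B K) x\<rangle> \<le> - \<mu> \<langle>Q x, x\<rangle>\<close>: the feedback contributes
  \<open>- \<parallel>B\<^sup>* p\<parallel>\<^sup>2 / \<mu>\<close>, which removes the only positive term.
\<close>

lemma pointwise_reachable_stabilizable:
  fixes P :: "complex set"
    and A :: "complex \<Rightarrow> complex ^ 'n ^ 'n"
    and B :: "complex \<Rightarrow> complex ^ 'm ^ 'n"
  assumes P: "compact P" "P \<noteq> {}" and A: "continuous_on P A" and B: "continuous_on P B"
    and reach: "pointwise_reachable P A B"
  shows "\<exists>K. continuous_on P K \<and> exponentially_stable P (mult_op (\<lambda>\<theta>. A \<theta> + B \<theta> ** K \<theta>))"
proof -
  obtain \<alpha> where \<alpha>: "\<alpha> > 0" "\<And>\<theta> x. \<theta> \<in> P \<Longrightarrow> norm (A \<theta> *v x) \<le> \<alpha> * norm x"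
    using compact_matrix_family_bounded[OF P(1) A] by blast
  define \<mu> where "\<mu> = \<alpha> + 1"
  have \<mu>: "\<mu> > 0" "\<mu> > \<alpha>" using \<alpha>(1) by (simp_all add: \<mu>_def)
  have inv: "invertible (A \<theta> + mat (complex_of_real \<mu>))" if \<theta>: "\<theta> \<in> P" for \<theta>
    unfolding invertible_left_inverse matrix_left_invertible_ker
  proof (intro allI impI)
    fix x assume "(A \<theta> + mat (complex_of_real \<mu>)) *v x = 0"
    then have "A \<theta> *v x = - (\<mu> *\<^sub>R x)"
      by (simp add: matrix_vector_mult_add_rdistrib mat_complex_of_real_vector eq_neg_iff_add_eq_0)
    then have "\<mu> * norm x \<le> \<alpha> * norm x" using \<alpha>(2)[OF \<theta>, of x] \<mu>(1) by simp
    then show "x = 0" using \<mu>(2) by (simp add: mult_le_cancel_right)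
  qed
  define W where "W \<theta> = gramian \<mu> (A \<theta>) (B \<theta>)" for \<theta>
  define Q where "Q \<theta> = matrix_inv (W \<theta>)" for \<theta>
  have W_pos: "x \<bullet> (W \<theta> *v x) > 0" if "\<theta> \<in> P" "x \<noteq> 0" for \<theta> x
    unfolding W_def
    by (rule gramian_positive[OF \<mu>(1) inv[OF that(1)] _ that(2)])
      (use reach that(1) in \<open>simp add: pointwise_reachable_def\<close>)
  have W_sym: "(W \<theta> *v x) \<bullet> y = x \<bullet> (W \<theta> *v y)" for \<theta> x y
    unfolding W_def by (subst inner_commute, unfold inner_gramian) (intro sum.cong refl inner_commute)
  have W_inv: "invertible (W \<theta>)" if "\<theta> \<in> P" for \<theta>
    unfolding invertible_left_inverse matrix_left_invertible_ker
    using W_pos[OF that] by (metis inner_zero_right less_irrefl)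
  have WQ: "W \<theta> *v (Q \<theta> *v x) = x" if "\<theta> \<in> P" for \<theta> x
    unfolding Q_def by (rule matrix_inv_right_vector[OF W_inv[OF that]])
  have Q_sym: "(Q \<theta> *v x) \<bullet> y = x \<bullet> (Q \<theta> *v y)" if "\<theta> \<in> P" for \<theta> x y
    using W_sym[of \<theta> "Q \<theta> *v x" "Q \<theta> *v y"] by (simp add: WQ[OF that])
  have Q_pos: "(Q \<theta> *v x) \<bullet> x > 0" if "\<theta> \<in> P" "x \<noteq> 0" for \<theta> x
  proof -
    have "Q \<theta> *v x \<noteq> 0" using WQ[OF that(1), of x] that(2) by auto
    from W_pos[OF that(1) this] show ?thesis by (simp add: WQ that(1))
  qed
  have Q_cont: "continuous_on P Q"
    unfolding Q_def using W_inv
    by (intro continuous_on_matrix_inv) (auto simp: W_def intro: continuous_on_gramian A B inv)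
  obtain C where C: "C > 0" "\<And>\<theta> x. \<theta> \<in> P \<Longrightarrow> norm (Q \<theta> *v x) \<le> C * norm x"
    using compact_matrix_family_bounded[OF P(1) Q_cont] by blast
  have upper: "(Q \<theta> *v x) \<bullet> x \<le> C * (norm x)\<^sup>2" if "\<theta> \<in> P" for \<theta> x
  proof -
    have "(Q \<theta> *v x) \<bullet> x \<le> norm (Q \<theta> *v x) * norm x" by (rule norm_cauchy_schwarz)
    also have "\<dots> \<le> C * norm x * norm x" using C(2)[OF that] by (rule mult_right_mono) simp
    finally show ?thesis by (simp add: power2_eq_square mult.assoc)
  qed
  obtain c where c: "c > 0" "\<And>\<theta> x. \<theta> \<in> P \<Longrightarrow> c * (norm x)\<^sup>2 \<le> (Q \<theta> *v x) \<bullet> x"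
    using compact_positive_family_bounded_below[OF P Q_cont Q_pos] by blast
  define \<kappa> where "\<kappa> = - (1 / (2 * \<mu>))"
  define K where "K \<theta> = \<kappa> *\<^sub>R (conj_transpose (B \<theta>) ** Q \<theta>)" for \<theta>
  have K_cont: "continuous_on P K"
    unfolding K_def
    by (intro continuous_intros continuous_on_matrix_mult continuous_on_conj_transpose B Q_cont)
  let ?F = "\<lambda>\<theta>. A \<theta> + B \<theta> ** K \<theta>"
  have F_cont: "continuous_on P ?F"
    by (intro continuous_intros continuous_on_matrix_mult A B K_cont)
  have lyap: "2 * ((Q \<theta> *v x) \<bullet> (?F \<theta> *v x)) \<le> - \<mu> * ((Q \<theta> *v x) \<bullet> x)" if \<theta>: "\<theta> \<in> P" for \<theta> x
  proof -
    define p where "p = Q \<theta> *v x"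
    have x: "x = W \<theta> *v p" unfolding p_def by (simp add: WQ \<theta>)
    have "?F \<theta> *v x = A \<theta> *v x + \<kappa> *\<^sub>R (B \<theta> *v (conj_transpose (B \<theta>) *v p))"
      by (simp add: K_def p_def matrix_vector_mult_add_rdistrib scaleR_complex_matrix_vector
          linear_scale[OF matrix_vector_mul_linear] flip: matrix_vector_mul_assoc)
    then have "2 * (p \<bullet> (?F \<theta> *v x)) =
        2 * (p \<bullet> (A \<theta> *v (W \<theta> *v p))) - (norm (conj_transpose (B \<theta>) *v p))\<^sup>2 / \<mu>"
      by (simp add: inner_diff_right right_diff_distrib inner_matrix_vector_right[of p "B \<theta>"]
          dot_square_norm \<kappa>_def flip: x)
    also have "\<dots> \<le> - \<mu> * (p \<bullet> (W \<theta> *v p))"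
      using gramian_lyapunov[OF \<mu>(1) inv[OF \<theta>], of p "B \<theta>"] by (simp add: W_def)
    finally show ?thesis unfolding p_def[symmetric] x[symmetric] .
  qed
  have "exponentially_stable P (mult_op ?F)"
  proof (rule mult_op_exponentially_stableI[OF P F_cont])
    show "\<mu> / 2 > 0" using \<mu>(1) by simp
    show "norm (exp_orbit ((*v) (?F \<theta>)) t x) \<le> sqrt (C / c) * exp (- (\<mu> / 2) * t) * norm x"
      if "\<theta> \<in> P" "t \<ge> 0" for \<theta> t x
      by (rule exp_orbit_decay[OF matrix_vector_mul_bounded_linear matrix_vector_mul_bounded_linear
            Q_sym[OF that(1)] c(1) c(2)[OF that(1)] upper[OF that(1)] lyap[OF that(1)] that(2)])
  qed
  with K_cont show ?thesis by blast
qed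

theorem theorem4p4:
  fixes P :: "complex set"
    and A :: "complex \<Rightarrow> complex ^ 'n ^ 'n"
    and B :: "complex \<Rightarrow> complex ^ 'm ^ 'n"
  assumes "(\<exists>a b. P = closed_segment a b) \<or> (\<exists>c r. r > 0 \<and> P = sphere c r)"
    and "continuous_on P A" and "continuous_on P B"
    and "pointwise_reachable P A B"
    and "\<exists>v :: complex ^ 'm. \<forall>\<theta>\<in>P. B \<theta> *v v \<noteq> 0"
  shows "\<exists>K :: complex \<Rightarrow> complex ^ 'n ^ 'm. continuous_on P K \<and>
           exponentially_stable P (mult_op (\<lambda>\<theta>. A \<theta> + B \<theta> ** K \<theta>))"
proof (rule pointwise_reachable_stabilizable)
  have "c + of_real r \<in> sphere c r" if "r > 0" for c :: complex and r
    using that by (simp add: dist_norm)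
  then have "sphere c r \<noteq> {}" if "r > 0" for c :: complex and r
    using that by blast
  with assms(1) show "P \<noteq> {}"
    by (elim disjE exE conjE) simp_all
  show "compact P"
    using assms(1) by (elim disjE exE conjE) simp_all
qed (fact assms)+

end
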